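(* Let $A\in\mathbb{R}^{n\times d}$ have singular values $\sigma_1\ge\sigma_2\ge\dots\ge\sigma_{\operatorname{rank}(A)}>0$, let $1\le k\le\operatorname{rank}(A)$ and let $\epsilon>0$. Let $p$ be the largest integer (with $p\le \operatorname{rank}(A)$, and $p=0$ if there is no such positive integer) such that $\sigma_p^2\ge\frac{\|A-A_k\|_F^2}{k}$. Suppose $S\in\mathbb{R}^{d\times m}$ satisfies: 1. $\left(1-\frac{\epsilon}{24}\right)AA^T-\lambda I\preceq ASS^TA^T\preceq\left(1+\frac{\epsilon}{24}\right)AA^T+\lambda I$ for $\lambda=\frac{\epsilon\cdot\|A-A_k\|_F^2}{24k}$; 2. $S$ satisfies $\frac{\epsilon}{12}\cdot\frac{\|A-A_k\|_F^2}{\|A-A_p\|_F^2}$-Frobenius norm preservation for $A_{\setminus p}=A-A_p$. Then $\tilde A=AS$ is an $(\epsilon,0,k)$-projection-cost-preserving sketch of $A$.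
   Context: $\|\cdot\|_F$ is the Frobenius norm, $I$ is the $n\times n$ identity matrix, and $M\preceq N$ means that $N-M$ is positive semidefinite. Projection-cost-preserving sketch. $\tilde A\in\mathbb{R}^{n\times m}$ is an $(\epsilon,c,k)$-projection-cost-preserving sketch of $A\in\mathbb{R}^{n\times d}$ if, for every orthogonal projection matrix $P\in\mathbb{R}^{n\times n}$ with rank at most $k$, $(1-\epsilon)\|A-PA\|_F^2\le \|\tilde A-P\tilde A\|_F^2+c\le (1+\epsilon)\|A-PA\|_F^2$, where $c$ is a constant independent of $P$. Frobenius norm preservation. $S\in\mathbb{R}^{d\times m}$ satisfies $\eta$-Frobenius norm preservation for $M\in\mathbb{R}^{n\times d}$ if $\left|\|M\|_F^2-\|MS\|_F^2\right|\le\eta\|M\|_F^2$. (If $A-A_p=0$, condition 2 is regarded as trivially satisfied.) Head-tail split. Let $A=U\Sigma V^T$ be the compact singular value decomposition, with $U\in\mathbb{R}^{n\times\operatorname{rank}(A)}$, $V\in\mathbb{R}^{d\times\operatorname{rank}(A)}$ having orthonormal columns and $\Sigma$ diagonal with entries $\sigma_1\ge\dots\ge\sigma_{\operatorname{rank}(A)}>0$. For $0\le r\le\operatorname{rank}(A)$, $U_r,V_r$ denote the first $r$ columns of $U,V$, $A_r=U_rU_r^TA=AV_rV_r^T$ (so $A_0=0$), and $A_{\setminus r}=A-A_r$. *)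

theory Defs
  imports "HOL-Analysis.Analysis"
begin

text \<open>
  An \<open>n \<times> d\<close> real matrix is a term of type \<open>real^'d^'n\<close>. The library norm on this type is the
  Euclidean norm of the vector of row norms, that is, the Frobenius norm.
\<close>

lemma norm_matrix_eq_frobenius:
  fixes M :: "real^'d^'n"
  shows "norm M = sqrt (\<Sum>i\<in>UNIV. \<Sum>j\<in>UNIV. (M $ i $ j)\<^sup>2)"
  by (simp add: norm_vec_def L2_set_def sum_nonneg)

definition pos_semidef :: "real^'n^'n \<Rightarrow> bool" where
  "pos_semidef M \<longleftrightarrow> transpose M = M \<and> (\<forall>x. 0 \<le> x \<bullet> (M *v x))"

definition loewner_le :: "real^'n^'n \<Rightarrow> real^'n^'n \<Rightarrow> bool"  (infix \<open>\<preceq>\<^sub>L\<close> 50) where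
  "M \<preceq>\<^sub>L N \<longleftrightarrow> pos_semidef (N - M)"

definition orth_proj :: "real^'n^'n \<Rightarrow> bool" where
  "orth_proj P \<longleftrightarrow> P ** P = P \<and> transpose P = P"

definition proj_cost_preserving ::
  "real \<Rightarrow> real \<Rightarrow> nat \<Rightarrow> real^'m^'n \<Rightarrow> real^'d^'n \<Rightarrow> bool" where
  "proj_cost_preserving \<epsilon> c k At A \<longleftrightarrow>
     (\<forall>P::real^'n^'n. orth_proj P \<and> rank P \<le> k \<longrightarrow>
        (1 - \<epsilon>) * (norm (A - P ** A))\<^sup>2 \<le> (norm (At - P ** At))\<^sup>2 + c \<and>
        (norm (At - P ** At))\<^sup>2 + c \<le> (1 + \<epsilon>) * (norm (A - P ** A))\<^sup>2)"

definition frob_preserving :: "real \<Rightarrow> real^'m^'d \<Rightarrow> real^'d^'n \<Rightarrow> bool" where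
  "frob_preserving \<eta> S M \<longleftrightarrow>
     \<bar>(norm M)\<^sup>2 - (norm (M ** S))\<^sup>2\<bar> \<le> \<eta> * (norm M)\<^sup>2"

definition orthonormal_upto :: "nat \<Rightarrow> (nat \<Rightarrow> real^'n) \<Rightarrow> bool" where
  "orthonormal_upto r u \<longleftrightarrow>
     (\<forall>i\<in>{1..r}. \<forall>j\<in>{1..r}. u i \<bullet> u j = (if i = j then 1 else 0))"

text \<open>
  The number of columns of \<open>U\<close> and \<open>V\<close> in a compact singular value decomposition is the rank of
  the matrix, which is not available as a type. The columns and the singular values are therefore
  given as sequences, of which only the entries with index \<open>1, \<dots>, rank A\<close> are used. Entry
  \<open>(a, b)\<close> of \<open>U \<Sigma> V\<^sup>T\<close> is then \<open>\<Sum>i. U\<^sub>a\<^sub>i \<sigma>\<^sub>i V\<^sub>b\<^sub>i\<close>.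
\<close>

definition compact_svd ::
  "real^'d^'n \<Rightarrow> (nat \<Rightarrow> real^'n) \<Rightarrow> (nat \<Rightarrow> real) \<Rightarrow> (nat \<Rightarrow> real^'d) \<Rightarrow> bool" where
  "compact_svd A u \<sigma> v \<longleftrightarrow>
     orthonormal_upto (rank A) u \<and> orthonormal_upto (rank A) v \<and>
     (\<forall>i\<in>{1..rank A}. 0 < \<sigma> i) \<and>
     (\<forall>i\<in>{1..rank A}. \<forall>j\<in>{1..rank A}. i \<le> j \<longrightarrow> \<sigma> j \<le> \<sigma> i) \<and>
     A = (\<chi> a b. \<Sum>i=1..rank A. u i $ a * \<sigma> i * v i $ b)"

text \<open>\<open>U\<^sub>r U\<^sub>r\<^sup>T\<close>, where \<open>U\<^sub>r\<close> has the columns \<open>u 1, \<dots>, u r\<close>.\<close>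

definition cols_proj :: "(nat \<Rightarrow> real^'n) \<Rightarrow> nat \<Rightarrow> real^'n^'n" where
  "cols_proj u r = (\<chi> a b. \<Sum>i=1..r. u i $ a * u i $ b)"

definition svd_head :: "(nat \<Rightarrow> real^'n) \<Rightarrow> real^'d^'n \<Rightarrow> nat \<Rightarrow> real^'d^'n" where
  "svd_head u A r = cols_proj u r ** A"

lemma svd_head_eq_sum:
  assumes "compact_svd A u \<sigma> v" "r \<le> rank A"
  shows "svd_head u A r = (\<chi> a b. \<Sum>i=1..r. u i $ a * \<sigma> i * v i $ b)"
proof -
  let ?R = "rank A"
  have A: "A $ a $ b = (\<Sum>i=1..?R. u i $ a * \<sigma> i * v i $ b)" for a b
    using assms(1) unfolding compact_svd_def by (metis (no_types, lifting) vec_lambda_beta)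
  have o: "u i \<bullet> u j = (if i = j then 1 else 0)" if "i \<in> {1..?R}" "j \<in> {1..?R}" for i j
    using assms(1) that unfolding compact_svd_def orthonormal_upto_def by blast
  have "(svd_head u A r) $ a $ b = (\<Sum>i=1..r. u i $ a * \<sigma> i * v i $ b)" for a b
  proof -
    have "(svd_head u A r) $ a $ b
        = (\<Sum>c\<in>UNIV. \<Sum>i=1..r. \<Sum>j=1..?R. u i $ a * u i $ c * (u j $ c * \<sigma> j * v j $ b))"
      by (simp add: svd_head_def cols_proj_def matrix_matrix_mult_def A sum_product)
    also have "\<dots> = (\<Sum>i=1..r. \<Sum>j=1..?R. \<Sum>c\<in>UNIV. u i $ a * u i $ c * (u j $ c * \<sigma> j * v j $ b))"
      by (subst sum.swap, intro sum.cong refl, rule sum.swap)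
    also have "\<dots> = (\<Sum>i=1..r. \<Sum>j=1..?R. u i $ a * \<sigma> j * v j $ b * (u i \<bullet> u j))"
      by (simp add: inner_vec_def sum_distrib_left algebra_simps)
    also have "\<dots> = (\<Sum>i=1..r. \<Sum>j=1..?R. if i = j then u i $ a * \<sigma> j * v j $ b else 0)"
      using assms(2) by (intro sum.cong refl) (simp add: o)
    also have "\<dots> = (\<Sum>i=1..r. u i $ a * \<sigma> i * v i $ b)"
      using assms(2) by (intro sum.cong refl) simp
    finally show ?thesis .
  qed
  then show ?thesis by (simp add: vec_eq_iff)
qed

lemma compact_svd_transpose:
  assumes "compact_svd A u \<sigma> v"
  shows "compact_svd (transpose A) v \<sigma> u"
proof -
  have "A = (\<chi> a b. \<Sum>i=1..rank A. u i $ a * \<sigma> i * v i $ b)"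
    using assms unfolding compact_svd_def by blast
  then have "A $ a $ b = (\<Sum>i=1..rank A. u i $ a * \<sigma> i * v i $ b)" for a b
    by (metis (no_types, lifting) vec_lambda_beta)
  then have "transpose A = (\<chi> a b. \<Sum>i=1..rank A. v i $ a * \<sigma> i * u i $ b)"
    by (simp add: transpose_def vec_eq_iff algebra_simps)
  moreover have "rank (transpose A) = rank A"
    by (rule rank_transpose)
  ultimately show ?thesis
    using assms unfolding compact_svd_def by metis
qed

text \<open>\<open>A\<^sub>r = A V\<^sub>r V\<^sub>r\<^sup>T\<close>.\<close>

lemma svd_head_eq_right:
  assumes "compact_svd A u \<sigma> v" "r \<le> rank A"
  shows "svd_head u A r = A ** cols_proj v r"
proof -
  have "r \<le> rank (transpose A)"
    using assms(2) by (simp add: rank_transpose)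
  then have "transpose (svd_head v (transpose A) r) = svd_head u A r"
    by (subst svd_head_eq_sum[OF compact_svd_transpose[OF assms(1)]], assumption,
        subst svd_head_eq_sum[OF assms], simp add: transpose_def vec_eq_iff algebra_simps)
  moreover have "transpose (cols_proj v r) = cols_proj v r"
    by (simp add: transpose_def cols_proj_def vec_eq_iff algebra_simps)
  ultimately show ?thesis
    by (simp add: svd_head_def matrix_transpose_mul transpose_transpose)
qed

end

(*
  With Y = I - P, H the projection onto the first p left singular vectors and L = I - H, the
  error E = (A S)(A S)^T - A A^T satisfies
    tr(Y E Y) = tr(Y H E H Y) + 2 tr(Y H E L Y) + tr(Y L E L Y).
  Put T = |A - A_k|_F^2 and D = |Y A|_F^2, so T <= D.  Condition 1 bounds E by
  (epsilon/24)(A A^T + (T/k) I).  On the head the squared singular values are at least T/k, so the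
  additive part is absorbed and the first term is at most (epsilon/12) D.  On the tail they are at
  most T/k; since tr(Y L E L Y) = tr(L E L) - tr(P L E L P), the last term is controlled by
  condition 2 and by rank P <= k.  The cross term equals 2 sum_{i<=p} u_i^T E L Y u_i and is
  bounded by polarization; at most k singular values beyond the k-th can have square >= T/k
  when T > 0, whence p T/k <= 2 T.
*)

theory Submission
  imports Defs
begin

section \<open>Frobenius norms of products, by rows and by columns\<close>

lemma norm_sq_rows:
  fixes M :: "real^'d^'n"
  shows "(norm M)\<^sup>2 = (\<Sum>a\<in>UNIV. (norm (M $ a))\<^sup>2)"
  by (simp add: norm_vec_def L2_set_def sum_nonneg)

lemma norm_sq_mult_vec:
  fixes X :: "real^'b^'n"
  shows "(norm (X *v y))\<^sup>2 = (\<Sum>a\<in>UNIV. (y \<bullet> X $ a)\<^sup>2)"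
  by (simp add: norm_vec_def L2_set_def sum_nonneg matrix_vector_mul_component inner_commute)

lemma row_matrix_mult:
  fixes X :: "real^'b^'n" and Z :: "real^'d^'b"
  shows "(X ** Z) $ a = X $ a v* Z"
  by (simp add: vec_eq_iff matrix_matrix_mult_def vector_matrix_mult_def mult.commute)

lemma norm_sq_matrix_mult:
  fixes X :: "real^'b^'n" and Z :: "real^'d^'b"
  shows "(norm (X ** Z))\<^sup>2 = (\<Sum>a\<in>UNIV. (norm (X $ a v* Z))\<^sup>2)"
  by (simp add: norm_sq_rows row_matrix_mult)

text \<open>The column form carries Pythagoras from vectors over to matrices, and with
  \<open>Z = mat 1\<close> it computes the norm of a projection.\<close>

lemma norm_sq_matrix_mult_columns:
  fixes X :: "real^'b^'n" and Z :: "real^'d^'b"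
  shows "(norm (X ** Z))\<^sup>2 = (\<Sum>b\<in>UNIV. (norm (X *v column b Z))\<^sup>2)"
proof -
  have "(norm (X *v column b Z))\<^sup>2 = (\<Sum>a\<in>UNIV. ((X ** Z) $ a $ b)\<^sup>2)" for b
    by (simp add: norm_vec_def L2_set_def sum_nonneg matrix_matrix_mult_def
        matrix_vector_mult_def column_def)
  then show ?thesis
    by (simp add: norm_matrix_eq_frobenius sum_nonneg) (rule sum.swap)
qed

lemma matrix_mult_diff_rdistrib: "(A - B) ** C = A ** C - B ** (C :: real^'d^'n)"
  by (simp add: vec_eq_iff matrix_matrix_mult_def sum_subtractf left_diff_distrib)

lemma matrix_mult_diff_ldistrib: "C ** (A - B) = C ** A - C ** (B :: real^'d^'n)"
  by (simp add: vec_eq_iff matrix_matrix_mult_def sum_subtractf right_diff_distrib)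

lemma transpose_diff: "transpose (A - B) = transpose A - transpose (B :: real^'d^'n)"
  by (simp add: vec_eq_iff transpose_def)

section \<open>Orthogonal projections\<close>

lemma orth_proj_self_adjoint:
  assumes "orth_proj P"
  shows "x \<bullet> (P *v y) = (P *v x) \<bullet> y"
  by (metis assms orth_proj_def dot_lmul_matrix transpose_matrix_vector)

lemma orth_proj_idem:
  assumes "orth_proj P"
  shows "P *v (P *v x) = P *v x"
  using assms by (simp add: orth_proj_def matrix_vector_mul_assoc)

lemma orth_proj_complement:
  assumes "orth_proj P"
  shows "orth_proj (mat 1 - P)"
  using assms unfolding orth_proj_def
  by (simp add: matrix_mult_diff_ldistrib matrix_mult_diff_rdistrib transpose_diff)

lemma orth_proj_norm_sq:
  assumes "orth_proj P"
  shows "(norm (P *v x))\<^sup>2 + (norm (x - P *v x))\<^sup>2 = (norm x)\<^sup>2"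
proof -
  have "(P *v x) \<bullet> (x - P *v x) = 0"
    using assms by (simp add: inner_diff_right orth_proj_self_adjoint orth_proj_idem)
  then show ?thesis
    using norm_add_Pythagorean[of "P *v x" "x - P *v x"] by (simp add: orthogonal_def)
qed

lemma orth_proj_norm_sq_matrix:
  fixes Z :: "real^'d^'n"
  assumes "orth_proj P"
  shows "(norm (P ** Z))\<^sup>2 + (norm ((mat 1 - P) ** Z))\<^sup>2 = (norm Z)\<^sup>2"
proof -
  have "(norm Z)\<^sup>2 = (norm (mat 1 ** Z))\<^sup>2" by simp
  also have "\<dots> = (\<Sum>b\<in>UNIV. (norm (column b Z))\<^sup>2)"
    by (simp only: norm_sq_matrix_mult_columns matrix_vector_mul_lid)
  finally show ?thesis
    by (simp add: norm_sq_matrix_mult_columns matrix_vector_mult_diff_rdistrib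
        orth_proj_norm_sq[OF assms] flip: sum.distrib)
qed

lemma column_mat_1: "column a (mat 1 :: real^'n^'n) = axis a 1"
  by (auto simp: column_def mat_def axis_def vec_eq_iff)

text \<open>In an orthonormal basis of the range, the squared norm of \<open>P *v x\<close> is the
  sum of \<open>(b \<bullet> x)\<^sup>2\<close>; summing over the standard unit vectors
  \<open>x\<close> leaves 1 for each basis vector. This is how the rank of \<open>P\<close> enters
  the estimates.\<close>

lemma orth_proj_norm_sq_eq_rank:
  fixes P :: "real^'n^'n"
  assumes "orth_proj P"
  shows "(norm P)\<^sup>2 = real (rank P)"
proof -
  let ?S = "range (\<lambda>x. P *v x)"
  have "subspace ?S"
    by (intro linear_subspace_image subspace_UNIV) (rule matrix_vector_mul_linear)
  then obtain B where B: "B \<subseteq> ?S" "pairwise orthogonal B" "\<And>x. x \<in> B \<Longrightarrow> norm x = 1"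
      "independent B" "card B = dim ?S" "span B = ?S"
    using orthonormal_basis_subspace by metis
  have fin: "finite B" using B(4) independent_imp_finite by blast
  have "(norm (P *v x))\<^sup>2 = (\<Sum>b\<in>B. (b \<bullet> x)\<^sup>2)" for x
  proof -
    have inB: "P *v b = b" if "b \<in> B" for b
      using B(1) that orth_proj_idem[OF assms] by auto
    have "P *v x \<in> span B" using B(6) by auto
    then have "(\<Sum>b\<in>B. ((P *v x) \<bullet> b) *\<^sub>R b) = P *v x"
      using orthonormal_basis_expand[OF B(2) B(3) _ fin] by simp
    then have "(norm (P *v x))\<^sup>2 = (P *v x) \<bullet> (\<Sum>b\<in>B. ((P *v x) \<bullet> b) *\<^sub>R b)"
      by (simp add: power2_norm_eq_inner)
    also have "\<dots> = (\<Sum>b\<in>B. ((P *v x) \<bullet> b)\<^sup>2)"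
      by (simp add: inner_sum_right power2_eq_square)
    also have "\<dots> = (\<Sum>b\<in>B. (b \<bullet> x)\<^sup>2)"
      by (intro sum.cong refl) (simp add: inB orth_proj_self_adjoint[OF assms] inner_commute)
    finally show ?thesis .
  qed
  then have "(norm P)\<^sup>2 = (\<Sum>a\<in>UNIV. \<Sum>b\<in>B. (b \<bullet> axis a 1)\<^sup>2)"
    using norm_sq_matrix_mult_columns[of P "mat 1"]
    by (simp add: column_mat_1)
  also have "\<dots> = (\<Sum>b\<in>B. (norm b)\<^sup>2)"
    by (subst sum.swap) (simp add: inner_axis norm_vec_def L2_set_def sum_nonneg)
  also have "\<dots> = real (rank P)"
    using B by (simp add: rank_dim_range)
  finally show ?thesis .
qed

section \<open>Orthonormal families and Bessel's inequality\<close>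

lemma orthonormal_upto_inner:
  assumes "orthonormal_upto r u" "i \<in> {1..r}" "j \<in> {1..r}"
  shows "u i \<bullet> u j = (if i = j then 1 else 0)"
  using assms unfolding orthonormal_upto_def by blast

lemma orthonormal_upto_mono:
  assumes "orthonormal_upto r u" "q \<le> r"
  shows "orthonormal_upto q u"
  using assms unfolding orthonormal_upto_def by simp

lemma orthonormal_upto_norm_sum:
  assumes "orthonormal_upto r u"
  shows "(norm (\<Sum>i=1..r. c i *\<^sub>R u i))\<^sup>2 = (\<Sum>i=1..r. (c i)\<^sup>2)"
proof -
  have "(norm (\<Sum>i=1..r. c i *\<^sub>R u i))\<^sup>2
      = (\<Sum>i=1..r. \<Sum>j=1..r. if i = j then c i * c j else 0)"
    unfolding power2_norm_eq_inner inner_sum_left inner_sum_right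
    by (intro sum.cong refl) (simp add: orthonormal_upto_inner[OF assms])
  then show ?thesis by (simp add: power2_eq_square)
qed

lemma cols_proj_mult_vec: "cols_proj u r *v x = (\<Sum>i=1..r. (u i \<bullet> x) *\<^sub>R u i)"
proof -
  have "(cols_proj u r *v x) $ a = (\<Sum>i=1..r. (u i \<bullet> x) *\<^sub>R u i) $ a" for a
    by (simp add: cols_proj_def matrix_vector_mult_def inner_vec_def sum_distrib_left
        sum_distrib_right mult_ac) (rule sum.swap)
  then show ?thesis by (simp add: vec_eq_iff)
qed

lemma cols_proj_mult_basis:
  assumes "orthonormal_upto r u" "q \<le> r" "j \<in> {1..r}"
  shows "cols_proj u q *v u j = (if j \<le> q then u j else 0)"
proof -
  have "cols_proj u q *v u j = (\<Sum>i=1..q. if i = j then u j else 0)"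
    unfolding cols_proj_mult_vec
    by (intro sum.cong refl) (use assms in \<open>auto simp: orthonormal_upto_inner[OF assms(1)]\<close>)
  then show ?thesis using assms by simp
qed

lemma orth_proj_cols_proj:
  assumes "orthonormal_upto r u"
  shows "orth_proj (cols_proj u r)"
proof -
  have "cols_proj u r *v (cols_proj u r *v x) = cols_proj u r *v x" for x
  proof -
    have "cols_proj u r *v (cols_proj u r *v x)
        = (\<Sum>i=1..r. (u i \<bullet> x) *\<^sub>R (cols_proj u r *v u i))"
      unfolding cols_proj_mult_vec[of u r x]
      by (simp only: linear_sum[OF matrix_vector_mul_linear] matrix_vector_mult_scaleR)
    also have "\<dots> = (\<Sum>i=1..r. (u i \<bullet> x) *\<^sub>R u i)"
      by (intro sum.cong refl) (simp add: cols_proj_mult_basis[OF assms])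
    finally show ?thesis by (simp only: cols_proj_mult_vec[of u r x])
  qed
  then have "cols_proj u r ** cols_proj u r = cols_proj u r"
    by (simp add: matrix_eq matrix_vector_mul_assoc)
  moreover have "transpose (cols_proj u r) = cols_proj u r"
    by (simp add: transpose_def cols_proj_def vec_eq_iff mult.commute)
  ultimately show ?thesis by (simp add: orth_proj_def)
qed

lemma norm_cols_proj_mult_vec:
  assumes "orthonormal_upto r u"
  shows "(norm (cols_proj u r *v x))\<^sup>2 = (\<Sum>i=1..r. (u i \<bullet> x)\<^sup>2)"
  by (simp add: cols_proj_mult_vec orthonormal_upto_norm_sum[OF assms] del: One_nat_def)

lemma Bessel_inequality:
  assumes "orthonormal_upto r u"
  shows "(\<Sum>i=1..r. (u i \<bullet> x)\<^sup>2) \<le> (norm x)\<^sup>2"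
proof -
  have "(norm (cols_proj u r *v x))\<^sup>2 \<le> (norm x)\<^sup>2"
    using orth_proj_norm_sq[OF orth_proj_cols_proj[OF assms], of x]
      zero_le_power2[of "norm (x - cols_proj u r *v x)"] by linarith
  then show ?thesis by (simp only: norm_cols_proj_mult_vec[OF assms])
qed

text \<open>Bessel applied to each row of \<open>X\<close>. For a projection \<open>X\<close> it
  bounds the total weight put on the singular vectors by the rank.\<close>

lemma sum_norm_sq_mult_le_norm_sq:
  fixes X :: "real^'b^'n"
  assumes "orthonormal_upto r u"
  shows "(\<Sum>i=1..r. (norm (X *v u i))\<^sup>2) \<le> (norm X)\<^sup>2"
proof -
  have "(\<Sum>i=1..r. (norm (X *v u i))\<^sup>2) = (\<Sum>a\<in>UNIV. \<Sum>i=1..r. (u i \<bullet> X $ a)\<^sup>2)"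
    by (simp add: norm_sq_mult_vec sum.swap[of _ "{1..r}"] del: One_nat_def)
  also have "\<dots> \<le> (norm X)\<^sup>2"
    unfolding norm_sq_rows by (intro sum_mono Bessel_inequality[OF assms])
  finally show ?thesis .
qed

section \<open>Singular value expansions and optimality of the head\<close>

lemma compact_svd_vec_mult:
  assumes "compact_svd A u \<sigma> v"
  shows "x v* A = (\<Sum>i=1..rank A. (\<sigma> i * (u i \<bullet> x)) *\<^sub>R v i)"
proof -
  have A: "A $ a $ b = (\<Sum>i=1..rank A. u i $ a * \<sigma> i * v i $ b)" for a b
    using assms unfolding compact_svd_def by (metis (no_types, lifting) vec_lambda_beta)
  have "(x v* A) $ b = (\<Sum>i=1..rank A. (\<sigma> i * (u i \<bullet> x)) *\<^sub>R v i) $ b" for b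
    by (simp add: vector_matrix_mult_def A inner_vec_def sum_distrib_right sum_distrib_left mult_ac)
       (rule sum.swap)
  then show ?thesis by (simp add: vec_eq_iff)
qed

lemma compact_svd_norm_vec_mult:
  assumes "compact_svd A u \<sigma> v"
  shows "(norm (x v* A))\<^sup>2 = (\<Sum>i=1..rank A. (\<sigma> i)\<^sup>2 * (u i \<bullet> x)\<^sup>2)"
proof -
  have "orthonormal_upto (rank A) v" using assms by (simp add: compact_svd_def)
  then show ?thesis
    by (simp add: compact_svd_vec_mult[OF assms] orthonormal_upto_norm_sum
        power_mult_distrib del: One_nat_def)
qed

text \<open>Summing over the rows of \<open>X\<close> collects the coefficients of each
  \<open>u i\<close> into the vector \<open>X *v u i\<close>, so left multiplication acts on the
  squared singular values through nonnegative weights.\<close>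

lemma compact_svd_norm_mult:
  fixes X :: "real^'n^'c" and A :: "real^'d^'n"
  assumes "compact_svd A u \<sigma> v"
  shows "(norm (X ** A))\<^sup>2 = (\<Sum>i=1..rank A. (\<sigma> i)\<^sup>2 * (norm (X *v u i))\<^sup>2)"
  by (simp add: norm_sq_matrix_mult norm_sq_mult_vec compact_svd_norm_vec_mult[OF assms]
      sum_distrib_left sum.swap[of _ "{1..rank A}"] del: One_nat_def)

lemma svd_tail_eq: "A - svd_head u A r = (mat 1 - cols_proj u r) ** A"
  unfolding svd_head_def matrix_mult_diff_rdistrib matrix_mul_lid ..

lemma norm_svd_tail:
  assumes "compact_svd A u \<sigma> v" "r \<le> rank A"
  shows "(norm (A - svd_head u A r))\<^sup>2 = (\<Sum>i=r+1..rank A. (\<sigma> i)\<^sup>2)"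
proof -
  have o: "orthonormal_upto (rank A) u" using assms by (simp add: compact_svd_def)
  have "(norm (A - svd_head u A r))\<^sup>2 = (\<Sum>i=1..rank A. if r < i then (\<sigma> i)\<^sup>2 else 0)"
    unfolding svd_tail_eq compact_svd_norm_mult[OF assms(1)]
    by (intro sum.cong refl)
       (use orthonormal_upto_inner[OF o] in
         \<open>auto simp: matrix_vector_mult_diff_rdistrib cols_proj_mult_basis[OF o assms(2)] norm_eq_sqrt_inner\<close>)
  also have "\<dots> = (\<Sum>i=r+1..rank A. (\<sigma> i)\<^sup>2)"
    by (intro sum.mono_neutral_cong_right) auto
  finally show ?thesis .
qed

text \<open>The cost is the sum of \<open>(\<sigma> i)\<^sup>2 * (1 - w i)\<close> with weights in
  [0,1] of total at most \<open>k\<close>. Such a sum is least when the weight sits on the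
  \<open>k\<close> largest values, as in the Eckart-Young theorem.\<close>

lemma norm_svd_tail_le_proj_cost:
  assumes svd: "compact_svd A u \<sigma> v" and k: "1 \<le> k" "k \<le> rank A"
    and P: "orth_proj P" "rank P \<le> k"
  shows "(norm (A - svd_head u A k))\<^sup>2 \<le> (norm ((mat 1 - P) ** A))\<^sup>2"
proof -
  let ?R = "rank A"
  have o: "orthonormal_upto ?R u"
    and pos: "\<And>i. i \<in> {1..?R} \<Longrightarrow> 0 < \<sigma> i"
    and mono: "\<And>i j. i \<in> {1..?R} \<Longrightarrow> j \<in> {1..?R} \<Longrightarrow> i \<le> j \<Longrightarrow> \<sigma> j \<le> \<sigma> i"
    using svd unfolding compact_svd_def by blast+
  define w where "w i = (norm (P *v u i))\<^sup>2" for i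
  have y: "(norm ((mat 1 - P) *v u i))\<^sup>2 = 1 - w i" if "i \<in> {1..?R}" for i
  proof -
    have "(norm (u i))\<^sup>2 = 1"
      using orthonormal_upto_inner[OF o that that] by (simp add: power2_norm_eq_inner)
    then show ?thesis
      using orth_proj_norm_sq[OF P(1), of "u i"]
      by (simp add: w_def matrix_vector_mult_diff_rdistrib)
  qed
  have "(\<Sum>i=1..?R. w i) \<le> (norm P)\<^sup>2"
    unfolding w_def by (rule sum_norm_sq_mult_le_norm_sq[OF o])
  also have "\<dots> \<le> k"
    using P by (simp add: orth_proj_norm_sq_eq_rank)
  finally have w: "(\<Sum>i=1..?R. w i) \<le> k" .
  have sq: "(\<sigma> j)\<^sup>2 \<le> (\<sigma> i)\<^sup>2" if "i \<in> {1..?R}" "j \<in> {1..?R}" "i \<le> j" for i j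
    using mono[OF that] pos[OF that(2)] by (intro power_mono) auto
  have ind: "(\<Sum>i=1..?R. if i \<le> k then 1 else 0) = real k"
  proof -
    have "(\<Sum>i=1..?R. if i \<le> k then 1 else 0) = (\<Sum>i=1..k. 1::real)"
      using k by (intro sum.mono_neutral_cong_right) auto
    then show ?thesis by simp
  qed
  \<comment> \<open>All differences from the optimal weights are priced at
    \<open>(\<sigma> k)\<^sup>2\<close>: weight missing among the first \<open>k\<close> values
    costs at least this price, weight placed later saves at most this price.\<close>
  have "0 \<le> (\<sigma> k)\<^sup>2 * (\<Sum>i=1..?R. (if i \<le> k then 1 else 0) - w i)"
    using w ind by (intro mult_nonneg_nonneg) (simp_all add: sum_subtractf del: One_nat_def)
  also have "\<dots> = (\<Sum>i=1..?R. (\<sigma> k)\<^sup>2 * ((if i \<le> k then 1 else 0) - w i))"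
    by (rule sum_distrib_left)
  also have "\<dots> \<le> (\<Sum>i=1..?R. (\<sigma> i)\<^sup>2 * (1 - w i) - (if k < i then (\<sigma> i)\<^sup>2 else 0))"
  proof (rule sum_mono)
    fix i assume i: "i \<in> {1..?R}"
    have w01: "0 \<le> w i" "w i \<le> 1"
      using y[OF i] zero_le_power2[of "norm ((mat 1 - P) *v u i)"] by (auto simp: w_def)
    have kR: "k \<in> {1..?R}" using k by simp
    show "(\<sigma> k)\<^sup>2 * ((if i \<le> k then 1 else 0) - w i)
        \<le> (\<sigma> i)\<^sup>2 * (1 - w i) - (if k < i then (\<sigma> i)\<^sup>2 else 0)"
    proof (cases "i \<le> k")
      case True
      then show ?thesis using mult_right_mono[OF sq[OF i kR True], of "1 - w i"] w01 by simp
    next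
      case False
      then show ?thesis using mult_right_mono[OF sq[OF kR i], of "w i"] w01
        by (simp add: algebra_simps)
    qed
  qed
  also have "\<dots> = (\<Sum>i=1..?R. (\<sigma> i)\<^sup>2 * (1 - w i)) - (\<Sum>i=k+1..?R. (\<sigma> i)\<^sup>2)"
  proof -
    have "(\<Sum>i=1..?R. if k < i then (\<sigma> i)\<^sup>2 else 0) = (\<Sum>i=k+1..?R. (\<sigma> i)\<^sup>2)"
      by (intro sum.mono_neutral_cong_right) auto
    then show ?thesis by (simp only: sum_subtractf)
  qed
  also have "\<dots> = (norm ((mat 1 - P) ** A))\<^sup>2 - (norm (A - svd_head u A k))\<^sup>2"
    unfolding norm_svd_tail[OF svd k(2)] compact_svd_norm_mult[OF svd]
    by (simp add: y del: One_nat_def)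
  finally show ?thesis by simp
qed

section \<open>The error form and polarization\<close>

text \<open>The bilinear form of \<open>B ** transpose B - A ** transpose A\<close>, as
  \<open>x v* B\<close> is \<open>transpose B *v x\<close>.\<close>

definition gram_diff :: "real^'m^'n \<Rightarrow> real^'d^'n \<Rightarrow> real^'n \<Rightarrow> real^'n \<Rightarrow> real" where
  "gram_diff B A x y = (x v* B) \<bullet> (y v* B) - (x v* A) \<bullet> (y v* A)"

lemma gram_diff_self: "gram_diff B A x x = (norm (x v* B))\<^sup>2 - (norm (x v* A))\<^sup>2"
  by (simp add: gram_diff_def power2_norm_eq_inner)

lemma gram_diff_commute: "gram_diff B A x y = gram_diff B A y x"
  by (simp add: gram_diff_def inner_commute)

lemma linear_vec_mult: "linear (\<lambda>x. x v* (A :: real^'d^'n))"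
  using matrix_vector_mul_linear[of "transpose A"] by simp

lemma linear_gram_diff: "linear (gram_diff B A x)"
  by (rule linearI)
     (simp_all add: gram_diff_def linear_add[OF linear_vec_mult] linear_scale[OF linear_vec_mult]
       inner_add_right right_diff_distrib)

lemma gram_diff_add_self:
  "gram_diff B A (x + y) (x + y)
     = gram_diff B A x x + 2 * gram_diff B A x y + gram_diff B A y y"
  using gram_diff_commute[of B A] linear_add[OF linear_gram_diff, of B A]
  by (smt (verit))

lemma gram_diff_polarization:
  "4 * gram_diff B A x y
     = gram_diff B A (x + y) (x + y) - gram_diff B A (x - y) (x - y)"
  using gram_diff_add_self[of B A x y] gram_diff_add_self[of B A x "- y"]
    linear_neg[OF linear_gram_diff, of B A] gram_diff_commute[of B A]
  by (smt (verit) diff_conv_add_uminus)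

text \<open>The left side is the trace of \<open>X\<close> times the error matrix times
  \<open>transpose X\<close>. Written over the rows of \<open>X\<close>, it can be bounded through
  the quadratic form alone.\<close>

lemma norm_sq_mult_diff_eq_sum_gram_diff:
  "(norm (X ** B))\<^sup>2 - (norm (X ** A))\<^sup>2 = (\<Sum>a\<in>UNIV. gram_diff B A (X $ a) (X $ a))"
  by (simp add: norm_sq_matrix_mult gram_diff_self sum_subtractf)

section \<open>Head, tail and cross terms under a spectral bound\<close>

text \<open>\<open>B\<close> stands for \<open>A ** S\<close>, and \<open>\<tau>\<close> separates
  the first \<open>p\<close> squared singular values from the rest. \<open>spectral\<close> is the
  two-sided Loewner bound tested on vectors, with additive part
  \<open>\<alpha> * \<tau>\<close>.\<close>

locale spectral_sketch =
  fixes A :: "real^'d^'n" and B :: "real^'m^'n"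
    and u :: "nat \<Rightarrow> real^'n" and v :: "nat \<Rightarrow> real^'d" and \<sigma> :: "nat \<Rightarrow> real"
    and p :: nat and \<alpha> \<tau> :: real
  assumes svd: "compact_svd A u \<sigma> v"
    and p_le: "p \<le> rank A"
    and head_ge: "\<And>i. i \<in> {1..p} \<Longrightarrow> \<tau> \<le> (\<sigma> i)\<^sup>2"
    and tail_le: "\<And>i. i \<in> {p+1..rank A} \<Longrightarrow> (\<sigma> i)\<^sup>2 \<le> \<tau>"
    and nonneg: "0 \<le> \<alpha>" "0 \<le> \<tau>"
    and spectral: "\<And>x. \<bar>(norm (x v* B))\<^sup>2 - (norm (x v* A))\<^sup>2\<bar>
                     \<le> \<alpha> * ((norm (x v* A))\<^sup>2 + \<tau> * (norm x)\<^sup>2)"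
begin

text \<open>The quadratic form of \<open>\<alpha> (A A\<^sup>T + \<tau> I)\<close>, which dominates the error form \<open>\<plusminus>E\<close>.\<close>

definition ridge :: "real^'n \<Rightarrow> real" where
  "ridge x = \<alpha> * ((norm (x v* A))\<^sup>2 + \<tau> * (norm x)\<^sup>2)"

abbreviation E :: "real^'n \<Rightarrow> real^'n \<Rightarrow> real" where "E \<equiv> gram_diff B A"
abbreviation H :: "real^'n^'n" where "H \<equiv> cols_proj u p"
abbreviation L :: "real^'n^'n" where "L \<equiv> mat 1 - H"

lemma orthonormal: "orthonormal_upto (rank A) u" "orthonormal_upto p u"
  using svd p_le orthonormal_upto_mono by (auto simp: compact_svd_def)

lemma orth_proj_head: "orth_proj H"
  using orthonormal(2) by (rule orth_proj_cols_proj)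

lemma orth_proj_tail: "orth_proj L"
  using orth_proj_head by (rule orth_proj_complement)

lemma abs_gram_diff_le: "\<bar>E x x\<bar> \<le> ridge x"
  unfolding gram_diff_self ridge_def by (rule spectral)

lemma ridge_parallelogram: "ridge (x + y) + ridge (x - y) = 2 * ridge x + 2 * ridge y"
  by (simp add: ridge_def power2_norm_eq_inner linear_add[OF linear_vec_mult]
      linear_diff[OF linear_vec_mult] inner_add_left inner_add_right inner_diff_left
      inner_diff_right inner_commute algebra_simps)

text \<open>Polarization bounds \<open>4 * \<bar>E x y\<bar>\<close> by
  \<open>ridge (x + y) + ridge (x - y)\<close>, which the parallelogram law collapses. This plays
  the part of Cauchy-Schwarz for the dominated form \<open>E\<close>.\<close>

lemma two_abs_gram_diff_le: "2 * \<bar>E x y\<bar> \<le> ridge x + ridge y"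
  using gram_diff_polarization[of B A x y] abs_gram_diff_le[of "x + y"]
    abs_gram_diff_le[of "x - y"] ridge_parallelogram[of x y]
  by linarith

lemma norm_head_mult:
  "(norm ((H *v x) v* A))\<^sup>2 = (\<Sum>i=1..p. (\<sigma> i)\<^sup>2 * (u i \<bullet> x)\<^sup>2)"
proof -
  have "(norm ((H *v x) v* A))\<^sup>2
      = (\<Sum>i=1..rank A. if i \<le> p then (\<sigma> i)\<^sup>2 * (u i \<bullet> x)\<^sup>2 else 0)"
    unfolding compact_svd_norm_vec_mult[OF svd]
    by (intro sum.cong refl)
       (simp add: orth_proj_self_adjoint[OF orth_proj_head]
         cols_proj_mult_basis[OF orthonormal(1) p_le])
  also have "\<dots> = (\<Sum>i=1..p. (\<sigma> i)\<^sup>2 * (u i \<bullet> x)\<^sup>2)"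
    using p_le by (intro sum.mono_neutral_cong_right) auto
  finally show ?thesis .
qed

text \<open>On the head each squared singular value is at least \<open>\<tau>\<close>, so the
  additive part of \<open>ridge\<close> is at most the multiplicative part; hence the factor
  2.\<close>

lemma ridge_head: "ridge (H *v x) \<le> 2 * \<alpha> * (\<Sum>i=1..p. (\<sigma> i)\<^sup>2 * (u i \<bullet> x)\<^sup>2)"
proof -
  have "\<tau> * (norm (H *v x))\<^sup>2 \<le> (\<Sum>i=1..p. (\<sigma> i)\<^sup>2 * (u i \<bullet> x)\<^sup>2)"
    unfolding norm_cols_proj_mult_vec[OF orthonormal(2)] sum_distrib_left
    by (intro sum_mono mult_right_mono head_ge) auto
  then have "ridge (H *v x) \<le> \<alpha> * ((\<Sum>i=1..p. (\<sigma> i)\<^sup>2 * (u i \<bullet> x)\<^sup>2)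
      + (\<Sum>i=1..p. (\<sigma> i)\<^sup>2 * (u i \<bullet> x)\<^sup>2))"
    unfolding ridge_def norm_head_mult by (intro mult_left_mono add_left_mono nonneg)
  then show ?thesis by simp
qed

lemma norm_tail_mult_le: "(norm ((L *v x) v* A))\<^sup>2 \<le> \<tau> * (norm x)\<^sup>2"
proof -
  have "(norm ((L *v x) v* A))\<^sup>2 \<le> (\<Sum>i=1..rank A. \<tau> * (u i \<bullet> x)\<^sup>2)"
    unfolding compact_svd_norm_vec_mult[OF svd]
  proof (rule sum_mono)
    fix i assume i: "i \<in> {1..rank A}"
    \<comment> \<open>\<open>L\<close> kills the first \<open>p\<close> singular vectors, so only
      values with square at most \<open>\<tau>\<close> survive.\<close>
    have *: "u i \<bullet> (L *v x) = (if i \<le> p then 0 else u i \<bullet> x)"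
      unfolding orth_proj_self_adjoint[OF orth_proj_tail]
      unfolding matrix_vector_mult_diff_rdistrib
      by (simp add: cols_proj_mult_basis[OF orthonormal(1) p_le i])
    show "(\<sigma> i)\<^sup>2 * (u i \<bullet> (L *v x))\<^sup>2 \<le> \<tau> * (u i \<bullet> x)\<^sup>2"
      using tail_le[of i] i nonneg by (auto simp: * intro: mult_right_mono)
  qed
  also have "\<dots> \<le> \<tau> * (norm x)\<^sup>2"
    unfolding sum_distrib_left[symmetric]
    by (intro mult_left_mono Bessel_inequality orthonormal nonneg)
  finally show ?thesis .
qed

text \<open>Here the roles are reversed: both parts of \<open>ridge\<close> are at most
  \<open>\<alpha> * \<tau> * (norm x)\<^sup>2\<close>.\<close>

lemma ridge_tail: "ridge (L *v x) \<le> 2 * \<alpha> * \<tau> * (norm x)\<^sup>2"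
proof -
  have "(norm (L *v x))\<^sup>2 \<le> (norm x)\<^sup>2"
    using orth_proj_norm_sq[OF orth_proj_tail, of x]
      zero_le_power2[of "norm (x - L *v x)"] by linarith
  then have "ridge (L *v x) \<le> \<alpha> * (\<tau> * (norm x)\<^sup>2 + \<tau> * (norm x)\<^sup>2)"
    unfolding ridge_def
    by (intro mult_left_mono add_mono norm_tail_mult_le nonneg)
  then show ?thesis by simp
qed

lemma cross_term_le:
  assumes "i \<in> {1..p}"
  shows "2 * \<bar>E (u i) (L *v y)\<bar> \<le> 2 * \<alpha> * ((\<sigma> i)\<^sup>2 * (norm y)\<^sup>2 + \<tau>)"
  \<comment> \<open>Scaling by \<open>norm y\<close> balances the two ridge terms, so that no square root appears.\<close>
proof (cases "y = 0")
  case True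
  then show ?thesis using nonneg by (simp add: linear_0[OF linear_gram_diff])
next
  case False
  define s where "s = norm y"
  have s: "s > 0" using False by (simp add: s_def)
  have "E (s *\<^sub>R u i) ((1 / s) *\<^sub>R (L *v y)) = E (u i) (L *v y)"
    using s by (simp add: linear_scale[OF linear_gram_diff] gram_diff_commute[of _ _ "s *\<^sub>R u i"]
        gram_diff_commute[of _ _ "u i"])
  moreover have "ridge (s *\<^sub>R u i) \<le> 2 * \<alpha> * ((\<sigma> i)\<^sup>2 * s\<^sup>2)"
  proof -
    have "H *v (s *\<^sub>R u i) = s *\<^sub>R u i"
      using assms by (simp add: matrix_vector_mult_scaleR cols_proj_mult_basis[OF orthonormal(2)])
    moreover have "(\<Sum>j=1..p. (\<sigma> j)\<^sup>2 * (u j \<bullet> (s *\<^sub>R u i))\<^sup>2)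
        = (\<Sum>j=1..p. if j = i then (\<sigma> i)\<^sup>2 * s\<^sup>2 else 0)"
      using assms by (intro sum.cong refl)
        (simp add: orthonormal_upto_inner[OF orthonormal(2)])
    moreover have "\<dots> = (\<sigma> i)\<^sup>2 * s\<^sup>2" using assms by simp
    ultimately show ?thesis using ridge_head[of "s *\<^sub>R u i"] by (simp del: One_nat_def)
  qed
  moreover have "ridge ((1 / s) *\<^sub>R (L *v y)) \<le> 2 * \<alpha> * \<tau>"
    using ridge_tail[of "(1 / s) *\<^sub>R y"] s
    by (simp add: matrix_vector_mult_scaleR) (simp add: s_def)
  ultimately show ?thesis
    using two_abs_gram_diff_le[of "s *\<^sub>R u i" "(1 / s) *\<^sub>R (L *v y)"]
    by (simp add: s_def distrib_left)
qed

text \<open>Head and cross terms each contribute one copy of the cost; the cross terms add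
  \<open>p * \<tau>\<close> and the part of the tail inside \<open>P\<close> adds
  \<open>rank P * \<tau>\<close>. The error on the whole tail stays on the right, to be bounded by
  Frobenius norm preservation.\<close>

lemma proj_cost_diff_le:
  assumes P: "orth_proj P"
  defines "Y \<equiv> mat 1 - P"
  shows "\<bar>(norm (Y ** B))\<^sup>2 - (norm (Y ** A))\<^sup>2\<bar>
    \<le> 2 * \<alpha> * (2 * (norm (Y ** A))\<^sup>2 + (real p + real (rank P)) * \<tau>)
      + \<bar>(norm (L ** B))\<^sup>2 - (norm (L ** A))\<^sup>2\<bar>"
proof -
  let ?D = "(norm (Y ** A))\<^sup>2"
  have Y: "orth_proj Y" unfolding Y_def by (rule orth_proj_complement[OF P])
  have row: "(X ** L) $ a = L *v (X $ a)" for X :: "real^'n^'n" and a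
    using orth_proj_tail by (simp add: row_matrix_mult orth_proj_def flip: transpose_matrix_vector)
  have head_le: "(\<Sum>i=1..p. (\<sigma> i)\<^sup>2 * (norm (Y *v u i))\<^sup>2) \<le> ?D"
    unfolding compact_svd_norm_mult[OF svd] using p_le by (intro sum_mono2) auto

  have split: "E (Y $ a) (Y $ a)
      = E (H *v Y $ a) (H *v Y $ a) + 2 * E (H *v Y $ a) (L *v Y $ a)
        + E (L *v Y $ a) (L *v Y $ a)" for a
    using gram_diff_add_self[of B A "H *v Y $ a" "L *v Y $ a"]
    by (simp add: matrix_vector_mult_diff_rdistrib)

  have head: "\<bar>\<Sum>a\<in>UNIV. E (H *v Y $ a) (H *v Y $ a)\<bar> \<le> 2 * \<alpha> * ?D"
  proof -
    have "\<bar>\<Sum>a\<in>UNIV. E (H *v Y $ a) (H *v Y $ a)\<bar>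
        \<le> (\<Sum>a\<in>UNIV. 2 * \<alpha> * (\<Sum>i=1..p. (\<sigma> i)\<^sup>2 * (u i \<bullet> Y $ a)\<^sup>2))"
      by (rule order_trans[OF sum_abs], rule sum_mono,
          rule order_trans[OF abs_gram_diff_le ridge_head])
    \<comment> \<open>Swapping the sums over rows and indices produces the first \<open>p\<close>
      terms of the expansion of \<open>?D\<close>.\<close>
    also have "\<dots> = 2 * \<alpha> * (\<Sum>i=1..p. (\<sigma> i)\<^sup>2 * (norm (Y *v u i))\<^sup>2)"
      by (simp add: norm_sq_mult_vec sum_distrib_left sum.swap[of _ "{1..p}"] del: One_nat_def)
    also have "\<dots> \<le> 2 * \<alpha> * ?D"
      using head_le nonneg by (intro mult_left_mono) auto
    finally show ?thesis .
  qed

  have cross: "\<bar>2 * (\<Sum>a\<in>UNIV. E (H *v Y $ a) (L *v Y $ a))\<bar> \<le> 2 * \<alpha> * (?D + real p * \<tau>)"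
  proof -
    have lin: "linear (\<lambda>x. E (u i) (L *v x))" for i
      using linear_compose[OF matrix_vector_mul_linear linear_gram_diff] by (simp add: o_def)
    \<comment> \<open>As \<open>Y\<close> is symmetric and idempotent, this sum over all rows
      collapses to one vector, which leaves one cross term for each head index and an additive error
      of order \<open>p * \<tau>\<close>.\<close>
    have col: "(\<Sum>a\<in>UNIV. (u i \<bullet> Y $ a) *\<^sub>R Y $ a) = Y *v u i" for i
    proof -
      have "(\<Sum>a\<in>UNIV. (u i \<bullet> Y $ a) *\<^sub>R Y $ a) = (Y *v u i) v* Y"
        by (simp add: vec_eq_iff vector_matrix_mult_def matrix_vector_mul_component
            inner_commute mult.commute)
      also have "\<dots> = Y *v (Y *v u i)"
        using Y by (simp add: orth_proj_def flip: transpose_matrix_vector)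
      finally show ?thesis using orth_proj_idem[OF Y] by simp
    qed
    have "E (H *v x) y = (\<Sum>i=1..p. (u i \<bullet> x) * E (u i) y)" for x y
      unfolding gram_diff_commute[of B A _ y] cols_proj_mult_vec
      by (simp add: linear_sum[OF linear_gram_diff] linear_scale[OF linear_gram_diff])
    then have "(\<Sum>a\<in>UNIV. E (H *v Y $ a) (L *v Y $ a))
        = (\<Sum>i=1..p. \<Sum>a\<in>UNIV. (u i \<bullet> Y $ a) * E (u i) (L *v Y $ a))"
      by (simp add: sum.swap[of _ "{1..p}"] del: One_nat_def)
    also have "\<dots> = (\<Sum>i=1..p. E (u i) (L *v (\<Sum>a\<in>UNIV. (u i \<bullet> Y $ a) *\<^sub>R Y $ a)))"
      by (simp add: linear_sum[OF lin] linear_scale[OF lin])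
    also have "\<dots> = (\<Sum>i=1..p. E (u i) (L *v (Y *v u i)))"
      by (simp only: col)
    finally have "\<bar>2 * (\<Sum>a\<in>UNIV. E (H *v Y $ a) (L *v Y $ a))\<bar>
        \<le> (\<Sum>i=1..p. 2 * \<bar>E (u i) (L *v (Y *v u i))\<bar>)"
      by (simp add: abs_mult sum_distrib_left[symmetric] sum_abs del: One_nat_def)
    also have "\<dots> \<le> (\<Sum>i=1..p. 2 * \<alpha> * ((\<sigma> i)\<^sup>2 * (norm (Y *v u i))\<^sup>2 + \<tau>))"
      by (intro sum_mono cross_term_le)
    also have "\<dots> = 2 * \<alpha> * ((\<Sum>i=1..p. (\<sigma> i)\<^sup>2 * (norm (Y *v u i))\<^sup>2) + real p * \<tau>)"
      by (simp add: sum_distrib_left[symmetric] sum.distrib del: One_nat_def)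
    also have "\<dots> \<le> 2 * \<alpha> * (?D + real p * \<tau>)"
      using head_le nonneg by (intro mult_left_mono) auto
    finally show ?thesis .
  qed

  \<comment> \<open>The squared row norms of \<open>P\<close> add up to its rank, independently of
    the dimension.\<close>
  have proj: "\<bar>(norm (P ** L ** B))\<^sup>2 - (norm (P ** L ** A))\<^sup>2\<bar> \<le> 2 * \<alpha> * (real (rank P) * \<tau>)"
  proof -
    have "\<bar>(norm (P ** L ** B))\<^sup>2 - (norm (P ** L ** A))\<^sup>2\<bar>
        \<le> (\<Sum>a\<in>UNIV. 2 * \<alpha> * \<tau> * (norm (P $ a))\<^sup>2)"
      unfolding norm_sq_mult_diff_eq_sum_gram_diff row
      by (rule order_trans[OF sum_abs], rule sum_mono,
          rule order_trans[OF abs_gram_diff_le ridge_tail])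
    also have "\<dots> = 2 * \<alpha> * \<tau> * (norm P)\<^sup>2"
      by (simp add: norm_sq_rows sum_distrib_left)
    finally show ?thesis by (simp add: orth_proj_norm_sq_eq_rank[OF P] mult_ac)
  qed

  \<comment> \<open>Bounding the rows of \<open>Y\<close> directly would cost the rank of
    \<open>Y\<close>. Pythagoras instead expresses the tail seen by \<open>Y\<close> as the full
    tail minus the part seen by \<open>P\<close>.\<close>
  have tail: "(\<Sum>a\<in>UNIV. E (L *v Y $ a) (L *v Y $ a))
      = ((norm (L ** B))\<^sup>2 - (norm (L ** A))\<^sup>2)
        - ((norm (P ** L ** B))\<^sup>2 - (norm (P ** L ** A))\<^sup>2)"
  proof -
    have "(\<Sum>a\<in>UNIV. E (L *v Y $ a) (L *v Y $ a)) = (norm (Y ** L ** B))\<^sup>2 - (norm (Y ** L ** A))\<^sup>2"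
      by (simp only: norm_sq_mult_diff_eq_sum_gram_diff row)
    then show ?thesis
      using orth_proj_norm_sq_matrix[OF P, of "L ** B"] orth_proj_norm_sq_matrix[OF P, of "L ** A"]
      by (simp add: Y_def matrix_mul_assoc)
  qed

  have "(norm (Y ** B))\<^sup>2 - ?D
      = (\<Sum>a\<in>UNIV. E (H *v Y $ a) (H *v Y $ a))
        + 2 * (\<Sum>a\<in>UNIV. E (H *v Y $ a) (L *v Y $ a))
        + (\<Sum>a\<in>UNIV. E (L *v Y $ a) (L *v Y $ a))"
    unfolding norm_sq_mult_diff_eq_sum_gram_diff
    by (simp add: split sum.distrib sum_distrib_left)
  then have "\<bar>(norm (Y ** B))\<^sup>2 - ?D\<bar> \<le> 2 * \<alpha> * ?D + 2 * \<alpha> * (?D + real p * \<tau>)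
      + 2 * \<alpha> * (real (rank P) * \<tau>) + \<bar>(norm (L ** B))\<^sup>2 - (norm (L ** A))\<^sup>2\<bar>"
    using head cross proj tail by linarith
  also have "\<dots> = 2 * \<alpha> * (2 * ?D + (real p + real (rank P)) * \<tau>)
      + \<bar>(norm (L ** B))\<^sup>2 - (norm (L ** A))\<^sup>2\<bar>"
    by (simp add: algebra_simps)
  finally show ?thesis .
qed

end

section \<open>From the Loewner bounds to the sketch guarantee\<close>

lemma loewner_le_inner:
  assumes "M \<preceq>\<^sub>L N"
  shows "x \<bullet> (M *v x) \<le> x \<bullet> (N *v x)"
  using assms
  by (simp add: loewner_le_def pos_semidef_def matrix_vector_mult_diff_rdistrib inner_diff_right)

lemma inner_mult_transpose:
  fixes B :: "real^'m^'n"
  shows "x \<bullet> ((B ** transpose B) *v x) = (norm (x v* B))\<^sup>2"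
  by (simp only: matrix_vector_mul_assoc[symmetric] dot_lmul_matrix[symmetric]
      transpose_matrix_vector power2_norm_eq_inner)

theorem theorem9:
  fixes A :: "real^'d^'n" and S :: "real^'m^'d"
    and u :: "nat \<Rightarrow> real^'n" and v :: "nat \<Rightarrow> real^'d" and \<sigma> :: "nat \<Rightarrow> real"
    and k p :: nat and \<epsilon> l :: real
  assumes svd: "compact_svd A u \<sigma> v"
    and k: "1 \<le> k" "k \<le> rank A"
    and eps: "\<epsilon> > 0"
    and p: "p = Max (insert 0 {i \<in> {1..rank A}. (\<sigma> i)\<^sup>2 \<ge> (norm (A - svd_head u A k))\<^sup>2 / real k})"
    and l: "l = \<epsilon> * (norm (A - svd_head u A k))\<^sup>2 / (24 * real k)"
    and lower: "(1 - \<epsilon> / 24) *\<^sub>R (A ** transpose A) - l *\<^sub>R mat 1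
                  \<preceq>\<^sub>L A ** S ** transpose S ** transpose A"
    and upper: "A ** S ** transpose S ** transpose A
                  \<preceq>\<^sub>L (1 + \<epsilon> / 24) *\<^sub>R (A ** transpose A) + l *\<^sub>R mat 1"
    and frob: "frob_preserving
                 (\<epsilon> / 12 * ((norm (A - svd_head u A k))\<^sup>2 / (norm (A - svd_head u A p))\<^sup>2))
                 S (A - svd_head u A p)"
  shows "proj_cost_preserving \<epsilon> 0 k (A ** S) A"
proof -
  define T where "T = (norm (A - svd_head u A k))\<^sup>2"
  define \<tau> where "\<tau> = T / real k"
  define I where "I = {i \<in> {1..rank A}. \<tau> \<le> (\<sigma> i)\<^sup>2}"
  have T0: "0 \<le> T" "0 \<le> \<tau>" and kT: "real k * \<tau> = T"
    using k by (simp_all add: T_def \<tau>_def)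
  have pI: "p = Max (insert 0 I)" and fin: "finite (insert 0 I)"
    using p by (simp_all add: I_def \<tau>_def T_def)
  \<comment> \<open>The inserted 0 covers the case that no squared singular value reaches
    \<open>\<tau>\<close>; the head is then empty.\<close>
  have pin: "p = 0 \<or> p \<in> I" using Max_in[OF fin] pI by simp
  have p_le: "p \<le> rank A" using pin by (auto simp: I_def)
  have sq: "(\<sigma> j)\<^sup>2 \<le> (\<sigma> i)\<^sup>2" if "i \<in> {1..rank A}" "j \<in> {1..rank A}" "i \<le> j" for i j
    using svd that unfolding compact_svd_def by (intro power_mono) (auto intro: less_imp_le)
  have head_ge: "\<tau> \<le> (\<sigma> i)\<^sup>2" if "i \<in> {1..p}" for i
  proof -
    have "\<tau> \<le> (\<sigma> p)\<^sup>2" using pin that by (auto simp: I_def)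
    also have "\<dots> \<le> (\<sigma> i)\<^sup>2" using that p_le by (intro sq) auto
    finally show ?thesis .
  qed
  have tail_le: "(\<sigma> i)\<^sup>2 \<le> \<tau>" if "i \<in> {p+1..rank A}" for i
  proof (rule ccontr)
    assume "\<not> (\<sigma> i)\<^sup>2 \<le> \<tau>"
    then have "i \<in> I" using that by (auto simp: I_def)
    then have "i \<le> p" using Max_ge[OF fin, of i] pI by simp
    then show False using that by simp
  qed
  \<comment> \<open>Each index from \<open>k+1\<close> to \<open>p\<close> contributes at least
    \<open>\<tau>\<close> to the tail sum \<open>T\<close>, so
    \<open>(p - k) * \<tau> \<le> T\<close>, while \<open>k * \<tau> = T\<close>. The product form
    includes the case \<open>T = 0\<close>.\<close>
  have p2: "real p * \<tau> \<le> 2 * T"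
  proof (cases "p \<le> k")
    case True
    then have "real p * \<tau> \<le> real k * \<tau>" using T0 by (intro mult_right_mono) auto
    then show ?thesis using kT T0 by linarith
  next
    case False
    have "real (p - k) * \<tau> = (\<Sum>i=k+1..p. \<tau>)" by simp
    also have "\<dots> \<le> (\<Sum>i=k+1..p. (\<sigma> i)\<^sup>2)" by (intro sum_mono head_ge) auto
    also have "\<dots> \<le> (\<Sum>i=k+1..rank A. (\<sigma> i)\<^sup>2)" using p_le by (intro sum_mono2) auto
    also have "\<dots> = T" unfolding T_def norm_svd_tail[OF svd k(2)] ..
    finally show ?thesis using kT False by (simp add: of_nat_diff left_diff_distrib)
  qed
  have l': "l = \<epsilon> / 24 * \<tau>" by (simp add: l T_def \<tau>_def)
  have spectral: "\<bar>(norm (x v* (A ** S)))\<^sup>2 - (norm (x v* A))\<^sup>2\<bar>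
      \<le> \<epsilon> / 24 * ((norm (x v* A))\<^sup>2 + \<tau> * (norm x)\<^sup>2)" for x
  proof -
    have AS: "A ** S ** transpose S ** transpose A = (A ** S) ** transpose (A ** S)"
      by (simp add: matrix_transpose_mul matrix_mul_assoc)
    show ?thesis
      using loewner_le_inner[OF lower, of x] loewner_le_inner[OF upper, of x]
      unfolding AS matrix_vector_mult_diff_rdistrib matrix_vector_mult_add_rdistrib
        scaleR_matrix_vector_assoc[symmetric] inner_diff_right inner_add_right inner_scaleR_right
        inner_mult_transpose matrix_vector_mul_lid l'
      by (simp add: power2_norm_eq_inner[of x, symmetric] algebra_simps abs_le_iff)
  qed
  interpret spectral_sketch A "A ** S" u v \<sigma> p "\<epsilon> / 24" \<tau>
    by unfold_locales (use eps svd p_le head_ge tail_le T0 spectral in auto)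
  have frobT: "\<bar>(norm (L ** (A ** S)))\<^sup>2 - (norm (L ** A))\<^sup>2\<bar> \<le> \<epsilon> / 12 * T"
  proof -
    have "\<bar>(norm (L ** A))\<^sup>2 - (norm (L ** A ** S))\<^sup>2\<bar>
        \<le> \<epsilon> / 12 * (T / (norm (L ** A))\<^sup>2) * (norm (L ** A))\<^sup>2"
      using frob unfolding frob_preserving_def svd_tail_eq T_def .
    \<comment> \<open>The factor \<open>(norm (L ** A))\<^sup>2\<close> cancels. If it vanishes,
      division by zero yields 0 and the bound reduces to nonnegativity of
      \<open>\<epsilon> / 12 * T\<close>.\<close>
    also have "\<dots> \<le> \<epsilon> / 12 * T"
      using eps T0 by (cases "norm (L ** A) = 0") auto
    finally show ?thesis by (simp add: abs_minus_commute matrix_mul_assoc)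
  qed
  show ?thesis
    unfolding proj_cost_preserving_def
  proof (intro allI impI, elim conjE)
    fix P :: "real^'n^'n"
    assume P: "orth_proj P" "rank P \<le> k"
    define D where "D = (norm ((mat 1 - P) ** A))\<^sup>2"
    define D' where "D' = (norm ((mat 1 - P) ** (A ** S)))\<^sup>2"
    have TD: "T \<le> D"
      unfolding T_def D_def by (rule norm_svd_tail_le_proj_cost[OF svd k P])
    have "real (rank P) * \<tau> \<le> T"
      unfolding kT[symmetric] using P T0 by (intro mult_right_mono) auto
    \<comment> \<open>5 = 2 + 2 + 1: \<open>p * \<tau>\<close> is at most \<open>2 * T\<close>,
      \<open>rank P * \<tau>\<close> is at most \<open>T\<close>, and
      \<open>T \<le> D\<close>.\<close>
    then have "2 * D + (real p + real (rank P)) * \<tau> \<le> 5 * D"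
      using p2 TD by (simp add: distrib_right)
    then have "2 * (\<epsilon> / 24) * (2 * D + (real p + real (rank P)) * \<tau>) \<le> 2 * (\<epsilon> / 24) * (5 * D)"
      using eps by (intro mult_left_mono) auto
    moreover have "\<epsilon> / 12 * T \<le> \<epsilon> / 12 * D"
      using eps TD by (intro mult_left_mono) auto
    ultimately have "\<bar>D' - D\<bar> \<le> 2 * (\<epsilon> / 24) * (5 * D) + \<epsilon> / 12 * D"
      using proj_cost_diff_le[OF P(1)] frobT unfolding D_def D'_def by linarith
    \<comment> \<open>The constants add up to 10/24 + 2/24 = 1/2.\<close>
    also have "\<dots> \<le> \<epsilon> * D"
      using eps by (simp add: D_def)
    finally have "\<bar>D' - D\<bar> \<le> \<epsilon> * D" .
    then have "(1 - \<epsilon>) * D \<le> D' + 0 \<and> D' + 0 \<le> (1 + \<epsilon>) * D"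
      by (simp add: algebra_simps abs_le_iff)
    then show "(1 - \<epsilon>) * (norm (A - P ** A))\<^sup>2 \<le> (norm (A ** S - P ** (A ** S)))\<^sup>2 + 0 \<and>
        (norm (A ** S - P ** (A ** S)))\<^sup>2 + 0 \<le> (1 + \<epsilon>) * (norm (A - P ** A))\<^sup>2"
      unfolding D_def D'_def matrix_mult_diff_rdistrib matrix_mul_lid .
  qed
qed

end
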